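(* Let $0<\lambda\le1$ and $m\ge1$. Suppose a strategy for a game $\mathsf G=(\mathcal X,\mathcal Y,\mathcal A,\mathcal B,p,V)$ uses $m$ EPR pairs and is accepted with probability $q$. Then there is a strategy for $\mathsf G$ using $N_m=2^m-1+2m$ copies of $\Psi_\lambda$ which is accepted with probability at least $$F_{m,\lambda}\,q\ \ge\ \lambda^2q,\qquad\text{where } F_{m,\lambda}=\frac{d+2(d-1)\lambda+(d-1)(d-2)\lambda^2}{d^2},\quad d=2^m .$$
   Context: $\Psi_\lambda=\frac12\left(|00\rangle\langle00|+|11\rangle\langle11|+\lambda|00\rangle\langle11|+\lambda|11\rangle\langle00|\right)$, a two-qubit state with one qubit held by each of Alice and Bob. An EPR pair is $\frac1{\sqrt2}(|00\rangle+|11\rangle)$. A game has finite question sets $\mathcal X,\mathcal Y$, finite answer sets $\mathcal A,\mathcal B$, a probability distribution $p$ on $\mathcal X\times\mathcal Y$ and a predicate $V(a,b|x,y)\in\{0,1\}$. A strategy on a shared bipartite state $\rho$ consists of POVMs $(A_a^x)_a$ for each $x$ and $(B_b^y)_b$ for each $y$ on the respective local spaces; its acceptance probability is $\sum_{x,y,a,b}p(x,y)V(a,b|x,y)\mathrm{Tr}[(A_a^x\otimes(B_b^y)^{\mathsf T})\rho]$ (transposition is a convention and does not restrict the strategies). *)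

theory Defs
  imports Complex_Main "Jordan_Normal_Form.Matrix"
begin

definition mat_trace :: "complex mat \<Rightarrow> complex" where
  "mat_trace M = (\<Sum>i<dim_row M. M $$ (i, i))"

definition kron :: "complex mat \<Rightarrow> complex mat \<Rightarrow> complex mat" where
  "kron M N = mat (dim_row M * dim_row N) (dim_col M * dim_col N)
     (\<lambda>(i, j). M $$ (i div dim_row N, j div dim_col N) * N $$ (i mod dim_row N, j mod dim_col N))"

(* |u><v| *)
definition ketbra :: "complex vec \<Rightarrow> complex vec \<Rightarrow> complex mat" where
  "ketbra u v = mat (dim_vec u) (dim_vec v) (\<lambda>(i, j). u $ i * cnj (v $ j))"

(* The two-qubit basis vector |ab>, with the first qubit Alice's and the second Bob's,
   has index 2 * a + b. *)
definition ket00 :: "complex vec" where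
  "ket00 = unit_vec 4 0"

definition ket11 :: "complex vec" where
  "ket11 = unit_vec 4 3"

definition epr_vec :: "complex vec" where
  "epr_vec = complex_of_real (1 / sqrt 2) \<cdot>\<^sub>v (ket00 + ket11)"

definition epr :: "complex mat" where
  "epr = ketbra epr_vec epr_vec"

definition Psi :: "real \<Rightarrow> complex mat" where
  "Psi l = (1 / 2) \<cdot>\<^sub>m
     (ketbra ket00 ket00 + ketbra ket11 ket11
      + complex_of_real l \<cdot>\<^sub>m ketbra ket00 ket11
      + complex_of_real l \<cdot>\<^sub>m ketbra ket11 ket00)"

(* The n-fold tensor power of a two-qubit state r, with the tensor factors regrouped so that
   Alice's n qubits come first and Bob's n qubits second. Each party's computational basis is
   indexed by {..<2^n}, bit k of the index being the value of the k-th qubit; the joint index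
   a * 2^n + b stands for |a>|b>, in agreement with kron. *)
definition copies :: "nat \<Rightarrow> complex mat \<Rightarrow> complex mat" where
  "copies n r = mat (2 ^ n * 2 ^ n) (2 ^ n * 2 ^ n)
     (\<lambda>(i, j). \<Prod>k<n. r $$
        (2 * of_bool (bit (i div 2 ^ n) k) + of_bool (bit (i mod 2 ^ n) k),
         2 * of_bool (bit (j div 2 ^ n) k) + of_bool (bit (j mod 2 ^ n) k)))"

(* The order on complex is that of Complex_Order: 0 \<le> z says that z is real and nonnegative. *)
definition psd :: "nat \<Rightarrow> complex mat \<Rightarrow> bool" where
  "psd D M \<longleftrightarrow> M \<in> carrier_mat D D \<and> (\<forall>v\<in>carrier_vec D. 0 \<le> (M *\<^sub>v v) \<bullet>c v)"

definition povm :: "nat \<Rightarrow> 'a set \<Rightarrow> ('a \<Rightarrow> complex mat) \<Rightarrow> bool" where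
  "povm D S E \<longleftrightarrow> (\<forall>a\<in>S. psd D (E a)) \<and>
     mat D D (\<lambda>ij. \<Sum>a\<in>S. E a $$ ij) = 1\<^sub>m D"

record ('x, 'y, 'a, 'b) game =
  questA :: "'x set"
  questB :: "'y set"
  ansA :: "'a set"
  ansB :: "'b set"
  qprob :: "'x \<Rightarrow> 'y \<Rightarrow> real"
  wins :: "'a \<Rightarrow> 'b \<Rightarrow> 'x \<Rightarrow> 'y \<Rightarrow> bool"

definition is_game :: "('x, 'y, 'a, 'b) game \<Rightarrow> bool" where
  "is_game G \<longleftrightarrow>
     finite (questA G) \<and> finite (questB G) \<and> finite (ansA G) \<and> finite (ansB G) \<and>
     (\<forall>x\<in>questA G. \<forall>y\<in>questB G. 0 \<le> qprob G x y) \<and>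
     (\<Sum>x\<in>questA G. \<Sum>y\<in>questB G. qprob G x y) = 1"

(* D is the dimension of each of the two local spaces. *)
definition is_strategy ::
  "('x, 'y, 'a, 'b) game \<Rightarrow> nat \<Rightarrow> ('x \<Rightarrow> 'a \<Rightarrow> complex mat) \<Rightarrow> ('y \<Rightarrow> 'b \<Rightarrow> complex mat) \<Rightarrow> bool" where
  "is_strategy G D A B \<longleftrightarrow>
     (\<forall>x\<in>questA G. povm D (ansA G) (A x)) \<and> (\<forall>y\<in>questB G. povm D (ansB G) (B y))"

(* The formula is a complex number, since the trace is; that it is a probability is not built in. *)
definition accept ::
  "('x, 'y, 'a, 'b) game \<Rightarrow> complex mat \<Rightarrow> ('x \<Rightarrow> 'a \<Rightarrow> complex mat) \<Rightarrow> ('y \<Rightarrow> 'b \<Rightarrow> complex mat) \<Rightarrow> complex" where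
  "accept G r A B =
     (\<Sum>x\<in>questA G. \<Sum>y\<in>questB G. \<Sum>a\<in>ansA G. \<Sum>b\<in>ansB G.
        complex_of_real (qprob G x y) * of_bool (wins G a b x y) *
        mat_trace (kron (A x a) (transpose_mat (B y b)) * r))"

definition F :: "nat \<Rightarrow> real \<Rightarrow> real" where
  "F m l = (let d = 2 ^ m in
     (d + 2 * (d - 1) * l + (d - 1) * (d - 2) * l\<^sup>2) / d\<^sup>2)"

end

theory Submission
  imports Defs
begin

text \<open>Copies of \<open>\<Psi>\<^sub>\<lambda>\<close> are supported on the vectors \<open>|s>|s>\<close>, and the coherence between
  \<open>|s>|s>\<close> and \<open>|t>|t>\<close> is multiplied by \<open>\<lambda>\<close> to the power of their Hamming distance. The perfect
  Hamming code of length \<open>d - 1\<close> cuts the strings into balls of radius 1 with \<open>d\<close> elements; both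
  parties measure the ball, which they agree on, and label the points of the ball by their syndrome,
  shifted by some \<open>r < d\<close>. What is left is a \<open>d\<close>-dimensional maximally entangled state damped by
  \<open>\<lambda>\<close> between the centre and the other points and by \<open>\<lambda>\<^sup>2\<close> between two points off the centre.
  On average over \<open>r\<close> the damping is the same for all pairs of distinct points, and the average acceptance probability
  is at least \<open>F q\<close> because a positive semidefinite kernel has sum at most \<open>d\<close> times its trace.
  Hence a single \<open>r\<close> attains this bound, so no shared randomness is consumed, and the other
  \<open>2m\<close> copies stay idle.\<close>

unbundle bit_operations_syntax

section \<open>Positive semidefinite kernels\<close>

text \<open>Kernels are plain functions rather than matrices, so that sums, scalings and entrywise
  products carry no dimensions; only indices below \<open>n\<close> count.\<close>

definition quad :: "nat \<Rightarrow> (nat \<Rightarrow> nat \<Rightarrow> complex) \<Rightarrow> (nat \<Rightarrow> complex) \<Rightarrow> complex" where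
  "quad n A x = (\<Sum>i<n. \<Sum>j<n. cnj (x i) * A i j * x j)"

definition psd_kernel :: "nat \<Rightarrow> (nat \<Rightarrow> nat \<Rightarrow> complex) \<Rightarrow> bool" where
  "psd_kernel n A \<longleftrightarrow> (\<forall>x. 0 \<le> quad n A x)"

lemma psd_kernelD: "psd_kernel n A \<Longrightarrow> 0 \<le> quad n A x"
  by (simp add: psd_kernel_def)

lemma psd_iff_psd_kernel:
  "psd n M \<longleftrightarrow> M \<in> carrier_mat n n \<and> psd_kernel n (\<lambda>i j. M $$ (i, j))"
proof (cases "M \<in> carrier_mat n n")
  case True
  have eq: "(M *\<^sub>v v) \<bullet>c v = quad n (\<lambda>i j. M $$ (i, j)) (\<lambda>i. v $ i)"
    if "v \<in> carrier_vec n" for v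
    using True that
    by (auto simp: quad_def scalar_prod_def sum_distrib_left sum_distrib_right
        lessThan_atLeast0 mult_ac intro!: sum.cong)
  have quad_vec: "quad n A x = quad n A (\<lambda>i. vec n x $ i)" for A x
    by (simp add: quad_def)
  show ?thesis
    unfolding psd_def psd_kernel_def using True eq quad_vec vec_carrier by metis
qed (simp add: psd_def)

lemma quad_pair:
  assumes "i < n" "j < n" "i \<noteq> j"
  shows "quad n A (\<lambda>k. if k = i then u else if k = j then v else 0) =
    cnj u * A i i * u + cnj u * A i j * v + cnj v * A j i * u + cnj v * A j j * v"
proof -
  let ?x = "\<lambda>k. if k = i then u else if k = j then v else 0"
  have "quad n A ?x = (\<Sum>k\<in>{i,j}. \<Sum>l\<in>{i,j}. cnj (?x k) * A k l * ?x l)"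
    unfolding quad_def
    using assms by (intro sum.mono_neutral_cong_right ballI sum.neutral) auto
  then show ?thesis
    using assms by (simp add: algebra_simps)
qed

lemma psd_kernel_diag_nonneg:
  assumes "psd_kernel n A" "i < n"
  shows "0 \<le> A i i"
proof -
  let ?x = "\<lambda>k. if k = i then 1 else 0"
  have "quad n A ?x = (\<Sum>k\<in>{i}. \<Sum>l\<in>{i}. cnj (?x k) * A k l * ?x l)"
    unfolding quad_def
    using assms by (intro sum.mono_neutral_cong_right ballI sum.neutral) auto
  then have "quad n A ?x = A i i"
    by simp
  then show ?thesis
    using psd_kernelD[OF assms(1)] by metis
qed

lemma psd_kernel_hermitian:
  assumes "psd_kernel n A" "i < n" "j < n"
  shows "A j i = cnj (A i j)"
proof (cases "i = j")
  case True
  then show ?thesis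
    using psd_kernel_diag_nonneg[OF assms(1,2)]
    by (auto simp: less_eq_complex_def complex_eq_iff)
next
  case False
  have d: "Im (A i i) = 0" "Im (A j j) = 0"
    using psd_kernel_diag_nonneg[OF assms(1)] assms(2,3) by (auto simp: less_eq_complex_def)
  \<comment> \<open>The complex order also forces the imaginary part to vanish. The test vectors
    \<open>(1, 1)\<close> and \<open>(1, \<i>)\<close> thus give
    \<open>Im (A j i) = - Im (A i j)\<close> and \<open>Re (A j i) = Re (A i j)\<close>.\<close>
  have "0 \<le> A i i + A i j + A j i + A j j"
    using psd_kernelD[OF assms(1), of "\<lambda>k. if k = i then 1 else if k = j then 1 else 0"]
      quad_pair[OF assms(2,3) False, of A 1 1] by simp
  moreover have "0 \<le> A i i + A i j * \<i> - \<i> * A j i + A j j"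
    using psd_kernelD[OF assms(1), of "\<lambda>k. if k = i then 1 else if k = j then \<i> else 0"]
      quad_pair[OF assms(2,3) False, of A 1 "\<i>"] by (simp add: algebra_simps)
  ultimately show ?thesis
    using d by (auto simp: less_eq_complex_def complex_eq_iff)
qed

text \<open>Along coordinate \<open>j\<close> the form has no quadratic term, so a nonzero
  \<open>A i j\<close> would make it negative far enough out. This settles zero pivots in Schur
  complements.\<close>

lemma psd_kernel_zero_diag:
  assumes "psd_kernel n A" "i < n" "j < n" "A j j = 0"
  shows "A i j = 0"
proof (rule ccontr)
  assume nz: "A i j \<noteq> 0"
  with assms have ij: "i \<noteq> j" by auto
  define a where "a = Re (A i i)"
  have a: "A i i = of_real a" "a \<ge> 0"
    using psd_kernel_diag_nonneg[OF assms(1,2)] 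
    by (auto simp: less_eq_complex_def complex_eq_iff a_def)
  \<comment> \<open>This size makes the form equal to \<open>a - 2 * (a + 1)\<close>, which is
    negative.\<close>
  define s where "s = (a + 1) / (cmod (A i j))\<^sup>2"
  have s: "of_real s * (A i j * cnj (A i j)) = of_real (a + 1)"
    using nz by (simp add: s_def complex_norm_square[symmetric])
  have h: "A j i = cnj (A i j)"
    using psd_kernel_hermitian assms by blast
  have "0 \<le> A i i - 2 * (of_real s * (A i j * cnj (A i j)))"
    using psd_kernelD[OF assms(1), of "\<lambda>k. if k = i then 1 else if k = j then - (of_real s * cnj (A i j)) else 0"]
      quad_pair[OF assms(2,3) ij, of A 1 "- (of_real s * cnj (A i j))"] assms(4) h
    by (simp add: algebra_simps)
  then show False
    unfolding s using a by (auto simp: less_eq_complex_def)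
qed

section \<open>Schur complements and the Schur product theorem\<close>

definition schur_compl :: "nat \<Rightarrow> (nat \<Rightarrow> nat \<Rightarrow> complex) \<Rightarrow> nat \<Rightarrow> nat \<Rightarrow> complex" where
  "schur_compl n A i j = A i j - A i n * A n j / A n n"

lemma psd_kernel_schur_compl:
  assumes "psd_kernel (Suc n) A"
  shows "psd_kernel n (schur_compl n A)"
  unfolding psd_kernel_def
proof
  fix x
  define p where "p = (\<Sum>j<n. A n j * x j)"
  define r where "r = (\<Sum>i<n. cnj (x i) * A i n)"
  \<comment> \<open>For a positive pivot this last coordinate minimises the form. For a zero pivot,
    division by zero gives \<open>t = 0\<close> and the Schur complement is \<open>A\<close> itself,
    so the same computation applies.\<close>
  define t where "t = - p / A n n"
  define y where "y = x(n := t)"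
  have "quad n (schur_compl n A) x =
      quad n A x - (\<Sum>i<n. \<Sum>j<n. (cnj (x i) * A i n) * (A n j * x j)) / A n n"
    by (simp add: quad_def schur_compl_def algebra_simps sum_subtractf sum_divide_distrib)
  also have "\<dots> = quad n A x - r * p / A n n"
    by (simp add: p_def r_def sum_product)
  finally have 1: "quad n (schur_compl n A) x = quad n A x - r * p / A n n" .
  have "quad (Suc n) A y = quad n A x + r * t + cnj t * (p + A n n * t)"
    by (simp add: quad_def y_def p_def r_def sum.distrib sum_distrib_left sum_distrib_right algebra_simps)
  also have "cnj t * (p + A n n * t) = 0"
    by (simp add: t_def)
  finally have "quad (Suc n) A y = quad n (schur_compl n A) x"
    unfolding 1 by (simp add: t_def)
  with psd_kernelD[OF assms] show "0 \<le> quad n (schur_compl n A) x"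
    by metis
qed

text \<open>By induction on the dimension: splitting off the last coordinate writes the first kernel
  as its Schur complement plus a rank-one kernel.\<close>

lemma psd_kernel_trace_mult_nonneg:
  assumes "psd_kernel n A" "psd_kernel n B"
  shows "0 \<le> (\<Sum>i<n. \<Sum>j<n. A i j * B j i)"
  using assms
proof (induction n arbitrary: A)
  case (Suc n)
  have "0 \<le> quad n B x" for x
  proof -
    have "quad n B x = quad (Suc n) B (x(n := 0))"
      by (simp add: quad_def)
    with psd_kernelD[OF Suc.prems(2)] show ?thesis by metis
  qed
  then have B: "psd_kernel n B" by (simp add: psd_kernel_def)
  let ?x = "\<lambda>i. A i n"
  have h: "A n j = cnj (A j n)" if "j \<le> n" for j
    using that psd_kernel_hermitian[OF Suc.prems(1), of j n] by simp
  have "(\<Sum>i<Suc n. \<Sum>j<Suc n. A i j * B j i) =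
     (\<Sum>i<Suc n. \<Sum>j<Suc n. schur_compl n A i j * B j i + A n j * B j i * A i n / A n n)"
    by (intro sum.cong refl) (simp add: schur_compl_def algebra_simps)
  also have "\<dots> = (\<Sum>i<Suc n. \<Sum>j<Suc n. schur_compl n A i j * B j i) +
     (\<Sum>i<Suc n. \<Sum>j<Suc n. A n j * B j i * A i n) / A n n"
    by (simp only: sum_divide_distrib sum.distrib)
  also have "(\<Sum>i<Suc n. \<Sum>j<Suc n. A n j * B j i * A i n) = quad (Suc n) B ?x"
    unfolding quad_def by (subst sum.swap) (intro sum.cong, auto simp: h)
  also have "(\<Sum>i<Suc n. \<Sum>j<Suc n. schur_compl n A i j * B j i) =
     (\<Sum>i<n. \<Sum>j<n. schur_compl n A i j * B j i)"
  proof -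
    \<comment> \<open>Elimination clears the last row and column. At a zero pivot nothing is
      subtracted, but then they vanish already by \<open>psd_kernel_zero_diag\<close>.\<close>
    have "schur_compl n A i n = 0" "schur_compl n A n i = 0" if "i \<le> n" for i
      using psd_kernel_zero_diag[OF Suc.prems(1), of i n] h[of i] that
      by (cases "A n n = 0"; auto simp: schur_compl_def)+
    then show ?thesis by simp
  qed
  finally have "(\<Sum>i<Suc n. \<Sum>j<Suc n. A i j * B j i) =
      (\<Sum>i<n. \<Sum>j<n. schur_compl n A i j * B j i) + quad (Suc n) B ?x / A n n" .
  moreover have "0 \<le> (\<Sum>i<n. \<Sum>j<n. schur_compl n A i j * B j i)"
    using Suc.IH psd_kernel_schur_compl Suc.prems(1) B by blast
  moreover have "0 \<le> quad (Suc n) B ?x / A n n"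
    using psd_kernelD[OF Suc.prems(2), of ?x] psd_kernel_diag_nonneg[OF Suc.prems(1), of n]
    by (auto simp: less_eq_complex_def Re_divide Im_divide)
  ultimately show ?case
    using add_nonneg_nonneg by simp
qed simp

text \<open>The form at \<open>x\<close> is the trace pairing of \<open>A\<close> with the congruent
  kernel \<open>cnj (x i) * B i j * x j\<close>. The transposition of \<open>A\<close> matches the
  entries \<open>M $$ (j, i) * L $$ (i, j)\<close> of the trace formula below.\<close>

lemma psd_kernel_schur_product:
  assumes "psd_kernel n A" "psd_kernel n B"
  shows "psd_kernel n (\<lambda>i j. A j i * B i j)"
  unfolding psd_kernel_def
proof
  fix x
  have "quad n (\<lambda>i j. cnj (x i) * B i j * x j) z = quad n B (\<lambda>i. x i * z i)" for z
    by (simp add: quad_def mult_ac)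
  then have "psd_kernel n (\<lambda>i j. cnj (x i) * B i j * x j)"
    using assms(2) by (simp add: psd_kernel_def)
  from psd_kernel_trace_mult_nonneg[OF assms(1) this]
  show "0 \<le> quad n (\<lambda>i j. A j i * B i j) x"
    unfolding quad_def by (subst sum.swap) (simp add: mult_ac)
qed

lemma psd_kernel_sum:
  assumes "\<And>s. s \<in> S \<Longrightarrow> psd_kernel n (K s)"
  shows "psd_kernel n (\<lambda>i j. \<Sum>s\<in>S. K s i j)"
  unfolding psd_kernel_def
proof
  fix x
  have "quad n (\<lambda>i j. \<Sum>s\<in>S. K s i j) x = (\<Sum>i<n. \<Sum>j<n. \<Sum>s\<in>S. cnj (x i) * K s i j * x j)"
    by (simp add: quad_def sum_distrib_left sum_distrib_right)
  also have "\<dots> = (\<Sum>i<n. \<Sum>s\<in>S. \<Sum>j<n. cnj (x i) * K s i j * x j)"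
    by (intro sum.cong refl sum.swap)
  also have "\<dots> = (\<Sum>s\<in>S. quad n (K s) x)"
    by (subst sum.swap) (simp add: quad_def)
  also have "0 \<le> \<dots>"
    using assms psd_kernelD by (intro sum_nonneg) blast
  finally show "0 \<le> quad n (\<lambda>i j. \<Sum>s\<in>S. K s i j) x" .
qed

lemma psd_kernel_scale:
  assumes "psd_kernel n K" "0 \<le> c"
  shows "psd_kernel n (\<lambda>i j. complex_of_real c * K i j)"
  unfolding psd_kernel_def
proof
  fix x
  have "quad n (\<lambda>i j. complex_of_real c * K i j) x = complex_of_real c * quad n K x"
    by (simp add: quad_def sum_distrib_left mult_ac)
  with psd_kernelD[OF assms(1), of x] assms(2)
  show "0 \<le> quad n (\<lambda>i j. complex_of_real c * K i j) x"
    by (simp add: less_eq_complex_def)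
qed

text \<open>The largest eigenvalue is at most the trace, tested on the all-ones vector.\<close>

lemma psd_kernel_sum_le_trace:
  assumes "psd_kernel n K"
  shows "(\<Sum>i<n. \<Sum>j<n. Re (K i j)) \<le> real n * (\<Sum>i<n. Re (K i i))"
proof -
  \<comment> \<open>No eigenvalues are used: testing on the difference of two unit vectors bounds
    each off-diagonal pair, and these bounds are summed.\<close>
  have "2 * Re (K i j) \<le> Re (K i i) + Re (K j j)" if "i < n" "j < n" for i j
  proof (cases "i = j")
    case False
    have "0 \<le> K i i - K i j - K j i + K j j"
      using psd_kernelD[OF assms, of "\<lambda>k. if k = i then 1 else if k = j then - 1 else 0"]
        quad_pair[OF that False, of K 1 "- 1"] by (simp add: algebra_simps)
    then show ?thesis
      using psd_kernel_hermitian[OF assms that] by (simp add: less_eq_complex_def)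
  qed simp
  then have "(\<Sum>i<n. \<Sum>j<n. 2 * Re (K i j)) \<le> (\<Sum>i<n. \<Sum>j<n. Re (K i i) + Re (K j j))"
    by (intro sum_mono) auto
  also have "\<dots> = 2 * (real n * (\<Sum>i<n. Re (K i i)))"
    by (simp add: sum.distrib sum_distrib_left)
  finally show ?thesis
    by (simp add: sum_distrib_left[symmetric])
qed

section \<open>Acceptance probability on copies of the noisy state\<close>

lemma Psi_index:
  assumes "i < 4" "j < 4"
  shows "Psi l $$ (i, j) =
    (if i \<in> {0, 3} \<and> j \<in> {0, 3} then (if i = j then 1 else of_real l) / 2 else 0)"
  using assms by (auto simp: Psi_def ketbra_def ket00_def ket11_def unit_vec_def)

text \<open>Both states thus fall under the same formulas, EPR pairs being the case without
  damping.\<close>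

lemma epr_eq_Psi: "epr = Psi 1"
proof (rule eq_matI)
  have c: "complex_of_real (1 / sqrt 2) * complex_of_real (1 / sqrt 2) = 1 / 2"
    by (simp only: of_real_mult[symmetric]) simp
  have vec: "epr_vec $ i = (if i \<in> {0, 3} then complex_of_real (1 / sqrt 2) else 0)" if "i < 4" for i
    using that by (auto simp: epr_vec_def ket00_def ket11_def unit_vec_def)
  fix i j assume "i < dim_row (Psi 1)" "j < dim_col (Psi 1)"
  then have ij: "i < 4" "j < 4"
    by (auto simp: Psi_def ketbra_def ket00_def ket11_def)
  have "epr $$ (i, j) = epr_vec $ i * cnj (epr_vec $ j)"
    using ij by (simp add: epr_def ketbra_def epr_vec_def ket00_def ket11_def)
  also have "\<dots> = (if i \<in> {0, 3} \<and> j \<in> {0, 3} then 1 / 2 else 0)"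
    unfolding vec[OF ij(1)] vec[OF ij(2)] using c
    by (simp del: of_real_divide split: if_split)
  also have "\<dots> = Psi 1 $$ (i, j)"
    by (simp add: Psi_index[OF ij])
  finally show "epr $$ (i, j) = Psi 1 $$ (i, j)" .
qed (auto simp: epr_def epr_vec_def Psi_def ketbra_def ket00_def ket11_def)

text \<open>A power of \<open>l\<close> whose exponent is the Hamming distance of the low
  \<open>n\<close> bits, kept as a product to match \<open>copies\<close>.\<close>

definition damping :: "nat \<Rightarrow> real \<Rightarrow> nat \<Rightarrow> nat \<Rightarrow> real" where
  "damping n l a b = (\<Prod>k<n. if bit a k = bit b k then 1 else l)"

lemma damping_one [simp]: "damping n 1 a b = 1"
  by (simp add: damping_def)

lemma eq_if_bits_eq:
  fixes a b :: nat
  assumes "a < 2 ^ n" "b < 2 ^ n" "\<And>k. k < n \<Longrightarrow> bit a k = bit b k"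
  shows "a = b"
proof -
  have "take_bit n a = take_bit n b"
    using assms(3) by (intro bit_eqI) (auto simp: bit_take_bit_iff)
  then show ?thesis
    using assms(1,2) by (simp add: take_bit_nat_eq_self)
qed

lemma pair_index_less:
  fixes a b D :: nat
  assumes "a < D" "b < D"
  shows "a * D + b < D * D"
proof -
  have "a * D + b < Suc a * D" using assms by simp
  also have "\<dots> \<le> D * D" using assms by (intro mult_right_mono) auto
  finally show ?thesis .
qed

text \<open>An entry of \<open>Psi l\<close> vanishes unless both of its indices are 0 or 3, that
  is, unless the bits of the two parties agree. A single disagreeing position kills the
  product.\<close>

lemma copies_Psi_index:
  assumes "a < 2 ^ n" "b < 2 ^ n" "a' < 2 ^ n" "b' < 2 ^ n"
  shows "copies n (Psi l) $$ (a * 2 ^ n + b, a' * 2 ^ n + b') =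
    (if a = b \<and> a' = b' then of_real (damping n l a a') / 2 ^ n else 0)"
proof -
  let ?P = "\<lambda>k. Psi l $$ (2 * of_bool (bit a k) + of_bool (bit b k),
    2 * of_bool (bit a' k) + of_bool (bit b' k))"
  have P: "?P k = (if bit a k = bit b k \<and> bit a' k = bit b' k
      then (if bit a k = bit a' k then 1 else of_real l) / 2 else 0)" for k
    by (subst Psi_index) (auto simp: of_bool_def)
  have "copies n (Psi l) $$ (a * 2 ^ n + b, a' * 2 ^ n + b') = (\<Prod>k<n. ?P k)"
    using assms by (simp add: copies_def pair_index_less)
  also have "\<dots> = (if a = b \<and> a' = b' then of_real (damping n l a a') / 2 ^ n else 0)"
  proof (cases "a = b \<and> a' = b'")
    case True
    then have "(\<Prod>k<n. ?P k) = (\<Prod>k<n. of_real (if bit a k = bit a' k then 1 else l) / 2)"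
      unfolding P by (intro prod.cong) auto
    also have "\<dots> = of_real (damping n l a a') / 2 ^ n"
      by (simp only: prod_dividef damping_def of_real_prod) simp
    finally show ?thesis using True by simp
  next
    case False
    then obtain k where "k < n" "\<not> (bit a k = bit b k \<and> bit a' k = bit b' k)"
      using eq_if_bits_eq assms by metis
    then have "(\<Prod>k<n. ?P k) = 0"
      unfolding P by (intro prod_zero) auto
    then show ?thesis by (simp only: False if_False)
  qed
  finally show ?thesis .
qed

lemma sum_lessThan_mult:
  fixes f :: "nat \<Rightarrow> 'a::comm_monoid_add"
  assumes "0 < D"
  shows "(\<Sum>i<D * D. f i) = (\<Sum>a<D. \<Sum>b<D. f (a * D + b))"
proof -
  have "(\<Sum>i<D * D. f i) = (\<Sum>(a, b)\<in>{..<D} \<times> {..<D}. f (a * D + b))"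
    by (rule sum.reindex_bij_witness[where j = "\<lambda>i. (i div D, i mod D)" and i = "\<lambda>(a, b). a * D + b"])
      (use assms in \<open>auto simp: less_mult_imp_div_less pair_index_less\<close>)
  then show ?thesis
    by (simp add: sum.cartesian_product)
qed

text \<open>The state forces the indices of the two parties to coincide, which leaves a double sum.
  The transposition makes the entries pair up as in the trace of \<open>M * L\<close>, weighted by
  the damping.\<close>

lemma trace_kron_copies_Psi:
  assumes "M \<in> carrier_mat (2 ^ n) (2 ^ n)" "L \<in> carrier_mat (2 ^ n) (2 ^ n)"
  shows "mat_trace (kron M (transpose_mat L) * copies n (Psi l)) =
    (\<Sum>i<2 ^ n. \<Sum>j<2 ^ n. of_real (damping n l i j) * (M $$ (j, i) * L $$ (i, j))) / 2 ^ n"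
proof -
  let ?D = "2 ^ n :: nat"
  let ?K = "kron M (transpose_mat L)" and ?R = "copies n (Psi l)"
  have dim: "?K \<in> carrier_mat (?D * ?D) (?D * ?D)" "?R \<in> carrier_mat (?D * ?D) (?D * ?D)"
    using assms by (auto simp: kron_def copies_def)
  have K: "?K $$ (a * ?D + b, a' * ?D + b') = M $$ (a, a') * L $$ (b', b)"
    if "a < ?D" "b < ?D" "a' < ?D" "b' < ?D" for a b a' b'
    using assms that by (simp add: kron_def pair_index_less)
  have "mat_trace (?K * ?R) = (\<Sum>i<?D * ?D. \<Sum>j<?D * ?D. ?K $$ (i, j) * ?R $$ (j, i))"
    using dim by (auto simp: mat_trace_def scalar_prod_def lessThan_atLeast0 intro!: sum.cong)
  also have "\<dots> = (\<Sum>a<?D. \<Sum>b<?D. \<Sum>a'<?D. \<Sum>b'<?D.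
      ?K $$ (a * ?D + b, a' * ?D + b') * ?R $$ (a' * ?D + b', a * ?D + b))"
    by (simp add: sum_lessThan_mult)
  also have "\<dots> = (\<Sum>a<?D. \<Sum>b<?D. \<Sum>a'<?D. \<Sum>b'<?D. if b = a then if b' = a' then
      M $$ (a, a') * L $$ (a', a) * (of_real (damping n l a' a) / 2 ^ n) else 0 else 0)"
    by (intro sum.cong refl) (simp add: K copies_Psi_index)
  also have "\<dots> = (\<Sum>a<?D. \<Sum>a'<?D. M $$ (a, a') * L $$ (a', a) * (of_real (damping n l a' a) / 2 ^ n))"
  proof (rule sum.cong[OF refl])
    fix a assume a: "a \<in> {..<?D}"
    have "(\<Sum>b<?D. \<Sum>a'<?D. \<Sum>b'<?D. if b = a then if b' = a' then
        M $$ (a, a') * L $$ (a', a) * (of_real (damping n l a' a) / 2 ^ n) else 0 else 0) =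
      (\<Sum>b<?D. if b = a then \<Sum>a'<?D. 
        M $$ (a, a') * L $$ (a', a) * (of_real (damping n l a' a) / 2 ^ n) else 0)"
      by (intro sum.cong refl) auto
    then show "(\<Sum>b<?D. \<Sum>a'<?D. \<Sum>b'<?D. if b = a then if b' = a' then
        M $$ (a, a') * L $$ (a', a) * (of_real (damping n l a' a) / 2 ^ n) else 0 else 0) =
      (\<Sum>a'<?D. M $$ (a, a') * L $$ (a', a) * (of_real (damping n l a' a) / 2 ^ n))"
      using a by simp
  qed
  also have "\<dots> = (\<Sum>i<?D. \<Sum>j<?D. of_real (damping n l i j) * (M $$ (j, i) * L $$ (i, j))) / 2 ^ n"
    unfolding sum_divide_distrib by (subst sum.swap, intro sum.cong refl) (simp add: mult_ac)
  finally show ?thesis .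
qed

text \<open>All that a strategy contributes to its acceptance on copies of \<open>Psi l\<close>; the
  noise enters only through factors multiplying this kernel.\<close>

definition correlation ::
  "('x, 'y, 'a, 'b) game \<Rightarrow> ('x \<Rightarrow> 'a \<Rightarrow> complex mat) \<Rightarrow> ('y \<Rightarrow> 'b \<Rightarrow> complex mat) \<Rightarrow>
    nat \<Rightarrow> nat \<Rightarrow> complex" where
  "correlation G A B i j =
     (\<Sum>x\<in>questA G. \<Sum>y\<in>questB G. \<Sum>a\<in>ansA G. \<Sum>b\<in>ansB G.
        complex_of_real (qprob G x y * of_bool (wins G a b x y)) * (A x a $$ (j, i) * B y b $$ (i, j)))"

lemma strategy_psd:
  assumes "is_strategy G D A B"
  shows "x \<in> questA G \<Longrightarrow> a \<in> ansA G \<Longrightarrow> psd D (A x a)"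
    and "y \<in> questB G \<Longrightarrow> b \<in> ansB G \<Longrightarrow> psd D (B y b)"
  using assms by (auto simp: is_strategy_def povm_def)

lemma psd_kernel_correlation:
  assumes "is_game G" "is_strategy G D A B"
  shows "psd_kernel D (correlation G A B)"
proof -
  have "psd_kernel D (\<lambda>i j. \<Sum>x\<in>questA G. \<Sum>y\<in>questB G. \<Sum>a\<in>ansA G. \<Sum>b\<in>ansB G.
        complex_of_real (qprob G x y * of_bool (wins G a b x y)) * (A x a $$ (j, i) * B y b $$ (i, j)))"
    using assms(1) strategy_psd[OF assms(2)]
    by (intro psd_kernel_sum psd_kernel_scale psd_kernel_schur_product)
      (auto simp: psd_iff_psd_kernel is_game_def)
  then show ?thesis
    by (simp add: correlation_def[abs_def])
qed

lemma accept_copies_Psi: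
  assumes "is_strategy G (2 ^ n) A B"
  shows "accept G (copies n (Psi l)) A B =
    (\<Sum>i<2 ^ n. \<Sum>j<2 ^ n. of_real (damping n l i j) * correlation G A B i j) / 2 ^ n"
proof -
  let ?c = "\<lambda>x y a b. complex_of_real (qprob G x y * of_bool (wins G a b x y))"
  let ?t = "\<lambda>x y a b i j. ?c x y a b * (of_real (damping n l i j) * (A x a $$ (j, i) * B y b $$ (i, j)))"
  \<comment> \<open>With \<open>(i, j)\<close> packed into one index, a single instance of
    \<open>sum.swap\<close> carries it outwards through all four sums.\<close>
  have pairs: "(\<Sum>i<2 ^ n. \<Sum>j<2 ^ n. ?t x y a b i j) =
      (\<Sum>(i, j)\<in>{..<2 ^ n} \<times> {..<2 ^ n}. ?t x y a b i j)" for x y a b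
    by (rule sum.cartesian_product)
  have "accept G (copies n (Psi l)) A B = (\<Sum>x\<in>questA G. \<Sum>y\<in>questB G. \<Sum>a\<in>ansA G. \<Sum>b\<in>ansB G.
      (\<Sum>i<2 ^ n. \<Sum>j<2 ^ n. ?t x y a b i j) / 2 ^ n)"
    unfolding accept_def using strategy_psd[OF assms]
    by (intro sum.cong refl, subst trace_kron_copies_Psi)
      (auto simp: psd_def sum_distrib_left sum_divide_distrib)
  also have "\<dots> = (\<Sum>x\<in>questA G. \<Sum>y\<in>questB G. \<Sum>a\<in>ansA G. \<Sum>b\<in>ansB G.
      \<Sum>(i, j)\<in>{..<2 ^ n} \<times> {..<2 ^ n}. ?t x y a b i j) / 2 ^ n"
    unfolding pairs by (simp only: sum_divide_distrib)
  also have "\<dots> = (\<Sum>(i, j)\<in>{..<2 ^ n} \<times> {..<2 ^ n}. \<Sum>x\<in>questA G. \<Sum>y\<in>questB G. \<Sum>a\<in>ansA G. \<Sum>b\<in>ansB G.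
      ?t x y a b i j) / 2 ^ n"
    by (simp only: sum.swap[where B = "{..<2 ^ n} \<times> {..<2 ^ n}"] case_prod_unfold)
  also have "\<dots> = (\<Sum>i<2 ^ n. \<Sum>j<2 ^ n. of_real (damping n l i j) * correlation G A B i j) / 2 ^ n"
    by (simp add: sum.cartesian_product[symmetric] correlation_def sum_distrib_left mult_ac)
  finally show ?thesis .
qed

section \<open>Measuring a common block\<close>

text \<open>\<open>\<psi>\<close> sends a string to the name of its block and its label there. The
  result is a direct sum of copies of \<open>M\<close>, one per block: measure the block, then apply
  \<open>M\<close> to the label.\<close>

definition block_mat :: "nat \<Rightarrow> (nat \<Rightarrow> nat \<times> nat) \<Rightarrow> complex mat \<Rightarrow> complex mat" where
  "block_mat D \<psi> M = mat D D
     (\<lambda>(s, t). if fst (\<psi> s) = fst (\<psi> t) then M $$ (snd (\<psi> s), snd (\<psi> t)) else 0)"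

lemma sum_blocks:
  fixes g :: "nat \<times> nat \<Rightarrow> nat \<times> nat \<Rightarrow> 'b::comm_monoid_add"
  assumes bij: "bij_betw \<psi> {..<D} (C \<times> {..<d})" and "finite C"
  shows "(\<Sum>s<D. \<Sum>t<D. if fst (\<psi> s) = fst (\<psi> t) then g (\<psi> s) (\<psi> t) else 0) =
    (\<Sum>c\<in>C. \<Sum>i<d. \<Sum>j<d. g (c, i) (c, j))"
proof -
  have "(\<Sum>s<D. \<Sum>t<D. if fst (\<psi> s) = fst (\<psi> t) then g (\<psi> s) (\<psi> t) else 0) =
      (\<Sum>p\<in>C \<times> {..<d}. \<Sum>q\<in>C \<times> {..<d}. if fst p = fst q then g p q else 0)"
    using sum.reindex_bij_betw[OF bij, of "\<lambda>p. \<Sum>q\<in>C \<times> {..<d}. if fst p = fst q then g p q else 0"]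
    by (simp add: sum.reindex_bij_betw[OF bij, of "\<lambda>q. if fst p = fst q then g p q else 0" for p])
  also have "\<dots> = (\<Sum>c\<in>C. \<Sum>i<d. \<Sum>c'\<in>C. \<Sum>j<d. if c = c' then g (c, i) (c', j) else 0)"
    by (simp add: sum.cartesian_product')
  also have "\<dots> = (\<Sum>c\<in>C. \<Sum>i<d. \<Sum>c'\<in>C. if c = c' then \<Sum>j<d. g (c, i) (c', j) else 0)"
    by (intro sum.cong refl) auto
  also have "\<dots> = (\<Sum>c\<in>C. \<Sum>i<d. \<Sum>j<d. g (c, i) (c, j))"
    using assms(2) by (intro sum.cong[OF refl]) simp
  finally show ?thesis .
qed

text \<open>The form at \<open>x\<close> splits into the forms of \<open>M\<close> at the
  restrictions of \<open>x\<close> to the blocks.\<close>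

lemma psd_block_mat:
  assumes bij: "bij_betw \<psi> {..<D} (C \<times> {..<d})" and "finite C" and "psd d M"
  shows "psd D (block_mat D \<psi> M)"
  unfolding psd_iff_psd_kernel psd_kernel_def
proof (intro conjI allI)
  show "block_mat D \<psi> M \<in> carrier_mat D D"
    by (simp add: block_mat_def)
  fix x :: "nat \<Rightarrow> complex"
  define y where "y = x \<circ> inv_into {..<D} \<psi>"
  have y: "y (\<psi> s) = x s" if "s < D" for s
    using bij_betw_inv_into_left[OF bij, of s] that by (simp add: y_def)
  have "quad D (\<lambda>i j. block_mat D \<psi> M $$ (i, j)) x =
      (\<Sum>s<D. \<Sum>t<D. if fst (\<psi> s) = fst (\<psi> t)
        then cnj (y (\<psi> s)) * M $$ (snd (\<psi> s), snd (\<psi> t)) * y (\<psi> t) else 0)"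
    unfolding quad_def by (intro sum.cong refl) (simp add: block_mat_def y)
  also have "\<dots> = (\<Sum>c\<in>C. quad d (\<lambda>i j. M $$ (i, j)) (\<lambda>i. y (c, i)))"
    unfolding quad_def
    using sum_blocks[OF assms(1,2), of "\<lambda>p q. cnj (y p) * M $$ (snd p, snd q) * y q"] by simp
  also have "0 \<le> \<dots>"
    using assms(3) by (intro sum_nonneg) (auto simp: psd_iff_psd_kernel psd_kernel_def)
  finally show "0 \<le> quad D (\<lambda>i j. block_mat D \<psi> M $$ (i, j)) x" .
qed

lemma povm_block_mat:
  assumes bij: "bij_betw \<psi> {..<D} (C \<times> {..<d})" and "finite C" and "povm d S E"
  shows "povm D S (\<lambda>a. block_mat D \<psi> (E a))"
  unfolding povm_def
proof
  show "\<forall>a\<in>S. psd D (block_mat D \<psi> (E a))"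
    using assms psd_block_mat unfolding povm_def by blast
  have E: "(\<Sum>a\<in>S. E a $$ (i, j)) = (if i = j then 1 else 0)" if "i < d" "j < d" for i j
  proof -
    have "mat d d (\<lambda>ij. \<Sum>a\<in>S. E a $$ ij) $$ (i, j) = 1\<^sub>m d $$ (i, j)"
      using assms(3) by (simp add: povm_def)
    with that show ?thesis by simp
  qed
  show "mat D D (\<lambda>ij. \<Sum>a\<in>S. block_mat D \<psi> (E a) $$ ij) = 1\<^sub>m D"
  proof (rule eq_matI)
    fix s t assume "s < dim_row (1\<^sub>m D :: complex mat)" "t < dim_col (1\<^sub>m D :: complex mat)"
    then have st: "s < D" "t < D" by auto
    have "\<psi> s \<in> C \<times> {..<d}" "\<psi> t \<in> C \<times> {..<d}"
      using bij_betwE[OF bij] st by auto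
    then have snd: "snd (\<psi> s) < d" "snd (\<psi> t) < d" by auto
    \<comment> \<open>Inside a block distinct strings have distinct labels, so the identity on
      labels pulls back to the identity on strings.\<close>
    have inj: "\<psi> s = \<psi> t \<longleftrightarrow> s = t"
      using bij st by (auto simp: bij_betw_def inj_on_def)
    show "mat D D (\<lambda>ij. \<Sum>a\<in>S. block_mat D \<psi> (E a) $$ ij) $$ (s, t) = 1\<^sub>m D $$ (s, t)"
      using st E[OF snd] inj
      by (cases "fst (\<psi> s) = fst (\<psi> t)") (auto simp: block_mat_def prod_eq_iff)
  qed auto
qed

lemma is_strategy_block_mat:
  assumes "bij_betw \<psi> {..<D} (C \<times> {..<d})" "finite C" "is_strategy G d A B"
  shows "is_strategy G D (\<lambda>x a. block_mat D \<psi> (A x a)) (\<lambda>y b. block_mat D \<psi> (B y b))"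
  using assms(3) by (auto simp: is_strategy_def intro!: povm_block_mat[OF assms(1,2)])

lemma correlation_block_mat:
  assumes "s < D" "t < D"
  shows "correlation G (\<lambda>x a. block_mat D \<psi> (A x a)) (\<lambda>y b. block_mat D \<psi> (B y b)) s t =
    (if fst (\<psi> s) = fst (\<psi> t) then correlation G A B (snd (\<psi> s)) (snd (\<psi> t)) else 0)"
  using assms by (simp add: correlation_def block_mat_def)

text \<open>Entries between different blocks are zero, and by \<open>w\<close> every block
  contributes the same sum. There are \<open>2 ^ n / d\<close> blocks, which turns the normalisation
  \<open>2 ^ n\<close> into \<open>d\<close>.\<close>

lemma accept_block_mat:
  assumes bij: "bij_betw \<psi> {..<2 ^ n} (C \<times> {..<d})" and "finite C" and "0 < d"
    and strat: "is_strategy G d A B"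
    and w: "\<And>s t. s < 2 ^ n \<Longrightarrow> t < 2 ^ n \<Longrightarrow> fst (\<psi> s) = fst (\<psi> t) \<Longrightarrow>
      damping n l s t = w (snd (\<psi> s)) (snd (\<psi> t))"
  shows "accept G (copies n (Psi l)) (\<lambda>x a. block_mat (2 ^ n) \<psi> (A x a))
      (\<lambda>y b. block_mat (2 ^ n) \<psi> (B y b)) =
    (\<Sum>i<d. \<Sum>j<d. of_real (w i j) * correlation G A B i j) / of_nat d"
proof -
  let ?S = "\<Sum>i<d. \<Sum>j<d. of_real (w i j) * correlation G A B i j"
  have "card C * d = 2 ^ n"
    using bij_betw_same_card[OF bij] by (simp add: card_cartesian_product)
  then have card: "of_nat (card C) * of_nat d = (2 ^ n :: complex)"
    by (metis of_nat_mult of_nat_numeral of_nat_power)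
  let ?c = "correlation G (\<lambda>x a. block_mat (2 ^ n) \<psi> (A x a)) (\<lambda>y b. block_mat (2 ^ n) \<psi> (B y b))"
  have "(\<Sum>s<2 ^ n. \<Sum>t<2 ^ n. of_real (damping n l s t) * ?c s t) =
      (\<Sum>s<2 ^ n. \<Sum>t<2 ^ n. if fst (\<psi> s) = fst (\<psi> t) then
        of_real (w (snd (\<psi> s)) (snd (\<psi> t))) * correlation G A B (snd (\<psi> s)) (snd (\<psi> t)) else 0)"
    by (intro sum.cong refl) (simp add: correlation_block_mat w)
  also have "\<dots> = of_nat (card C) * ?S"
    using sum_blocks[OF assms(1,2),
        of "\<lambda>p q. of_real (w (snd p) (snd q)) * correlation G A B (snd p) (snd q)"] by simp
  finally show ?thesis
    unfolding accept_copies_Psi[OF is_strategy_block_mat[OF assms(1,2) strat]] card[symmetric]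
    using card \<open>0 < d\<close> by (auto simp: field_simps)
qed

section \<open>Blocks from the Hamming code\<close>

text \<open>Label 0 stands for no flip and label \<open>k + 1\<close> for position \<open>k\<close>,
  so the labels up to \<open>n\<close> enumerate the ball of radius 1 around
  \<open>c\<close>.\<close>

fun flip :: "nat \<Rightarrow> nat \<Rightarrow> nat" where
  "flip c 0 = c"
| "flip c (Suc k) = flip_bit k c"

text \<open>The parity check of the Hamming code: the column of position \<open>k\<close> is the
  binary expansion of \<open>k + 1\<close>.\<close>

fun syndrome :: "nat \<Rightarrow> nat \<Rightarrow> nat" where
  "syndrome 0 s = 0"
| "syndrome (Suc n) s = (if bit s n then syndrome n s XOR Suc n else syndrome n s)"

lemma xor_left_cancel_nat [simp]:
  fixes a b :: nat
  shows "a XOR (a XOR b) = b"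
  by (simp flip: xor.assoc)

lemma bit_flip: "bit (flip c i) k \<longleftrightarrow> bit c k \<noteq> (i = Suc k)"
  by (cases i) (auto simp: bit_flip_bit_iff)

lemma flip_flip [simp]: "flip (flip c i) i = c"
  by (rule bit_eqI) (auto simp: bit_flip)

lemma xor_less_power2:
  fixes a b :: nat
  assumes "a < 2 ^ n" "b < 2 ^ n"
  shows "a XOR b < 2 ^ n"
  using assms by (metis take_bit_nat_eq_self_iff take_bit_xor)

lemma flip_less_power2:
  assumes "c < 2 ^ n" "i \<le> n"
  shows "flip c i < 2 ^ n"
proof (cases i)
  case (Suc k)
  have "push_bit k (1::nat) < 2 ^ n"
    using assms Suc by (simp add: push_bit_eq_mult)
  then show ?thesis
    using assms xor_less_power2 by (simp add: Suc flip_bit_eq_xor)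
qed (use assms in simp)

lemma syndrome_less_power2:
  assumes "n < 2 ^ m"
  shows "syndrome n s < 2 ^ m"
  using assms by (induction n) (auto intro: xor_less_power2)

lemma syndrome_flip:
  assumes "i \<le> n"
  shows "syndrome n (flip s i) = syndrome n s XOR i"
proof -
  \<comment> \<open>The induction on \<open>n\<close> also meets flips beyond the first
    \<open>n\<close> positions, which leave the syndrome unchanged.\<close>
  have *: "syndrome n (flip s i) = (if i \<le> n then syndrome n s XOR i else syndrome n s)" for n
    by (induction n) (auto simp: bit_flip xor.assoc xor.left_commute xor.commute le_Suc_eq)
  show ?thesis using assms by (simp add: *)
qed

text \<open>Each word differs from the centre in at most one place, so two words of a ball are at
  distance 0, 1 or 2.\<close>

lemma damping_flip:
  assumes "i \<le> n" "j \<le> n"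
  shows "damping n l (flip c i) (flip c j) =
    (if i = j then 1 else if i = 0 \<or> j = 0 then l else l\<^sup>2)"
proof -
  have "damping n l (flip c i) (flip c j) = (\<Prod>k<n. if (i = Suc k) = (j = Suc k) then 1 else l)"
    unfolding damping_def by (intro prod.cong) (auto simp: bit_flip)
  also have "\<dots> = (\<Prod>k\<in>{k. k < n \<and> (i = Suc k) \<noteq> (j = Suc k)}. l)"
    by (intro prod.mono_neutral_cong_right) auto
  also have "\<dots> = l ^ card {k. k < n \<and> (i = Suc k) \<noteq> (j = Suc k)}"
    by simp
  also have "{k. k < n \<and> (i = Suc k) \<noteq> (j = Suc k)} =
      (if i = j then {} else if i = 0 then {j - 1} else if j = 0 then {i - 1} else {i - 1, j - 1})"
    using assms by auto
  also have "l ^ card \<dots> = (if i = j then 1 else if i = 0 \<or> j = 0 then l else l\<^sup>2)"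
    using assms by (cases i; cases j) (auto simp: power2_eq_square)
  finally show ?thesis .
qed

text \<open>The ball is named by its centre. With \<open>flip c 0 = c\<close>, the point of label \<open>i XOR r\<close> in the ball
  around \<open>c\<close> is \<open>flip c i\<close>, so the centre itself has label \<open>r\<close>.\<close>

definition hamming_block :: "nat \<Rightarrow> nat \<Rightarrow> nat \<Rightarrow> nat \<times> nat" where
  "hamming_block m r s =
     (let i = syndrome (2 ^ m - 1) s in (flip s i, i XOR r))"

text \<open>The code is perfect: by \<open>syndrome_flip\<close>, flipping the position named by the
  syndrome gives a codeword, and the syndrome of \<open>flip c i\<close> recovers \<open>i\<close>.
  The inverse undoes the shift by \<open>r\<close> and then flips.\<close>

lemma bij_betw_hamming_block:
  assumes "2 ^ m - 1 \<le> n" "r < 2 ^ m"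
  shows "bij_betw (hamming_block m r) {..<2 ^ n}
    ({c. c < 2 ^ n \<and> syndrome (2 ^ m - 1) c = 0} \<times> {..<2 ^ m})"
proof (rule bij_betw_byWitness[where f' = "\<lambda>(c, i). flip c (i XOR r)"])
  have syn: "syndrome (2 ^ m - 1) s < 2 ^ m" for s
    by (intro syndrome_less_power2) simp
  have le: "i \<le> 2 ^ m - 1" "i \<le> n" if "i < 2 ^ m" for i
    using that assms(1) by auto
  have synf: "syndrome (2 ^ m - 1) (flip s i) = syndrome (2 ^ m - 1) s XOR i" if "i < 2 ^ m" for s i
    using that by (intro syndrome_flip) simp
  show "\<forall>s\<in>{..<2 ^ n}. (case hamming_block m r s of (c, i) \<Rightarrow> flip c (i XOR r)) = s"
    by (simp add: hamming_block_def Let_def xor.assoc)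
  show "\<forall>p\<in>{c. c < 2 ^ n \<and> syndrome (2 ^ m - 1) c = 0} \<times> {..<2 ^ m}.
      hamming_block m r (case p of (c, i) \<Rightarrow> flip c (i XOR r)) = p"
    using assms(2) by (auto simp: hamming_block_def Let_def synf xor_less_power2 xor.assoc simp del: One_nat_def)
  show "hamming_block m r ` {..<2 ^ n} \<subseteq> {c. c < 2 ^ n \<and> syndrome (2 ^ m - 1) c = 0} \<times> {..<2 ^ m}"
    using syn le assms(2)
    by (auto simp: hamming_block_def Let_def synf xor_less_power2 flip_less_power2 simp del: One_nat_def)
  show "(\<lambda>(c, i). flip c (i XOR r)) `
      ({c. c < 2 ^ n \<and> syndrome (2 ^ m - 1) c = 0} \<times> {..<2 ^ m}) \<subseteq> {..<2 ^ n}"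
    using assms(2) le by (auto intro!: flip_less_power2 simp: xor_less_power2)
qed

text \<open>The exponent of \<open>l\<close> is the distance between \<open>i\<close> and
  \<open>j\<close> in the star graph with centre \<open>r\<close>.\<close>

definition star_weight :: "real \<Rightarrow> nat \<Rightarrow> nat \<Rightarrow> nat \<Rightarrow> real" where
  "star_weight l r i j = (if i = j then 1 else if i = r \<or> j = r then l else l\<^sup>2)"

lemma xor_nat_cancel [simp]:
  fixes a b r :: nat
  shows "a XOR r = b XOR r \<longleftrightarrow> a = b" "a XOR r = r \<longleftrightarrow> a = 0"
  by (metis xor.assoc xor.right_neutral xor_self_eq)+

lemma damping_hamming_block:
  assumes "2 ^ m - 1 \<le> n" and eq: "fst (hamming_block m r s) = fst (hamming_block m r t)"
  shows "damping n l s t =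
    star_weight l r (snd (hamming_block m r s)) (snd (hamming_block m r t))"
proof -
  define i where "i = syndrome (2 ^ m - 1) s"
  define j where "j = syndrome (2 ^ m - 1) t"
  define c where "c = flip s i"
  have c': "flip t j = c"
    using eq by (simp add: hamming_block_def Let_def i_def j_def c_def)
  have "s = flip c i" "t = flip c j"
    unfolding c_def[symmetric] by (simp add: c_def, simp flip: c')
  moreover have "i < 2 ^ m" "j < 2 ^ m"
    unfolding i_def j_def by (intro syndrome_less_power2; simp)+
  ultimately have "damping n l s t = (if i = j then 1 else if i = 0 \<or> j = 0 then l else l\<^sup>2)"
    using damping_flip[of i n j l c] assms(1) by auto
  then show ?thesis
    by (simp add: star_weight_def hamming_block_def Let_def i_def j_def)
qed

section \<open>Averaging the damping over the shift\<close>

lemma sum_star_weight: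
  assumes "i < d" "j < d"
  shows "(\<Sum>r<d. star_weight l r i j) =
    (if i = j then real d else 2 * l + (real d - 2) * l\<^sup>2)"
proof (cases "i = j")
  case False
  \<comment> \<open>Two of the shifts, \<open>r = i\<close> and \<open>r = j\<close>, carry
    \<open>l\<close>; all others carry \<open>l\<^sup>2\<close>.\<close>
  then have "(\<Sum>r<d. star_weight l r i j) =
      (\<Sum>r<d. l\<^sup>2 + ((if r = i then l - l\<^sup>2 else 0) + (if r = j then l - l\<^sup>2 else 0)))"
    by (intro sum.cong) (auto simp: star_weight_def)
  also have "\<dots> = real d * l\<^sup>2 + 2 * (l - l\<^sup>2)"
    using assms by (simp add: sum.distrib)
  finally show ?thesis
    using False by (simp add: algebra_simps)
qed (simp add: star_weight_def)

lemma exists_ge_average: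
  fixes f :: "nat \<Rightarrow> real"
  assumes "0 < d" "real d * c \<le> (\<Sum>r<d. f r)"
  shows "\<exists>r<d. c \<le> f r"
proof (rule ccontr)
  assume "\<not> ?thesis"
  then have "(\<Sum>r<d. f r) < (\<Sum>r<d. c)"
    using assms(1) by (intro sum_strict_mono) auto
  with assms(2) show False by simp
qed

text \<open>Summed over \<open>r\<close>, the weights are \<open>g\<close> off the diagonal and
  \<open>d\<close> on it, so the total is \<open>g * S + (d - g) * T\<close> with \<open>T\<close>
  the trace of \<open>K\<close>. The bound \<open>S \<le> d * T\<close> then gives
  \<open>d * F m l * S\<close>.\<close>

lemma exists_star_weight_ge:
  fixes K :: "nat \<Rightarrow> nat \<Rightarrow> real"
  assumes l: "0 < l" "l \<le> 1" and "1 \<le> m"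
    and le: "(\<Sum>i<2 ^ m. \<Sum>j<2 ^ m. K i j) \<le> 2 ^ m * (\<Sum>i<2 ^ m. K i i)"
  shows "\<exists>r<2 ^ m. F m l * (\<Sum>i<2 ^ m. \<Sum>j<2 ^ m. K i j) \<le>
    (\<Sum>i<2 ^ m. \<Sum>j<2 ^ m. star_weight l r i j * K i j)"
proof (rule exists_ge_average)
  define d where "d = (2 ^ m :: nat)"
  define e where "e = real d"
  define S where "S = (\<Sum>i<d. \<Sum>j<d. K i j)"
  define T where "T = (\<Sum>i<d. K i i)"
  define g where "g = 2 * l + (e - 2) * l\<^sup>2"
  have "2 ^ 1 \<le> d" unfolding d_def by (intro power_increasing) (use assms in auto)
  then have e: "2 \<le> e" by (simp add: e_def)
  have "l\<^sup>2 \<le> 1" using l by (simp add: power_le_one)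
  then have g: "g \<le> e"
    using e l mult_left_mono[of "l\<^sup>2" 1 "e - 2"] by (simp add: g_def)
  have "(\<Sum>r<d. \<Sum>i<d. \<Sum>j<d. star_weight l r i j * K i j) =
      (\<Sum>i<d. \<Sum>r<d. \<Sum>j<d. star_weight l r i j * K i j)"
    by (rule sum.swap)
  also have "\<dots> = (\<Sum>i<d. \<Sum>j<d. \<Sum>r<d. star_weight l r i j * K i j)"
    by (rule sum.cong[OF refl], rule sum.swap)
  also have "\<dots> = (\<Sum>i<d. \<Sum>j<d. (\<Sum>r<d. star_weight l r i j) * K i j)"
    by (simp add: sum_distrib_right)
  also have "\<dots> = (\<Sum>i<d. \<Sum>j<d. g * K i j + (if j = i then (e - g) * K i i else 0))"
    by (intro sum.cong refl) (simp add: sum_star_weight g_def e_def algebra_simps)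
  also have "\<dots> = g * S + (e - g) * T"
    by (simp add: S_def T_def sum.distrib sum_distrib_left)
  finally have sum: "(\<Sum>r<d. \<Sum>i<d. \<Sum>j<d. star_weight l r i j * K i j) = g * S + (e - g) * T" .
  have F: "e * F m l = (e + (e - 1) * g) / e"
    using e by (simp add: F_def Let_def g_def e_def d_def power2_eq_square field_simps)
  \<comment> \<open>This product is exactly the difference of the two sides in the next
    inequality.\<close>
  have "0 \<le> (e - g) * (e * T - S)"
    using g le by (intro mult_nonneg_nonneg) (simp_all add: S_def T_def e_def d_def)
  then have "(e + (e - 1) * g) * S \<le> e * (g * S + (e - g) * T)"
    by (simp add: algebra_simps)
  then have "e * (F m l * S) \<le> g * S + (e - g) * T"
    unfolding mult.assoc[symmetric] F using e by (simp add: pos_divide_le_eq mult.commute)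
  then show "real (2 ^ m) * (F m l * (\<Sum>i<2 ^ m. \<Sum>j<2 ^ m. K i j)) \<le>
      (\<Sum>r<2 ^ m. \<Sum>i<2 ^ m. \<Sum>j<2 ^ m. star_weight l r i j * K i j)"
    using sum by (simp add: S_def e_def d_def)
qed simp

text \<open>\<open>F\<close> is the mean of the \<open>d\<^sup>2\<close> entries of a star weight
  matrix, each of which is at least \<open>l\<^sup>2\<close>.\<close>

lemma F_ge_square:
  assumes "0 < l" "l \<le> 1" "1 \<le> m"
  shows "l\<^sup>2 \<le> F m l"
proof -
  define d :: real where "d = 2 ^ m"
  have d: "1 \<le> d" by (simp add: d_def)
  have sq: "l\<^sup>2 \<le> l" "l\<^sup>2 \<le> 1"
    using assms by (auto simp: power2_eq_square mult_left_le mult_le_one)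
  have "d * l\<^sup>2 + 2 * (d - 1) * l\<^sup>2 \<le> d + 2 * (d - 1) * l"
    using sq d by (intro add_mono mult_left_mono mult_left_le) auto
  then have "l\<^sup>2 * d\<^sup>2 \<le> d + 2 * (d - 1) * l + (d - 1) * (d - 2) * l\<^sup>2"
    by (simp add: power2_eq_square algebra_simps)
  then show ?thesis
    using d by (simp add: F_def Let_def d_def[symmetric] pos_le_divide_eq)
qed

theorem corollary5p4:
  fixes G :: "('x, 'y, 'a, 'b) game"
    and A :: "'x \<Rightarrow> 'a \<Rightarrow> complex mat" and B :: "'y \<Rightarrow> 'b \<Rightarrow> complex mat"
    and l q :: real and m N :: nat
  assumes "0 < l" and "l \<le> 1" and "1 \<le> m"
    and "is_game G"
    and "is_strategy G (2 ^ m) A B"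
    and "accept G (copies m epr) A B = complex_of_real q"
    and "N = 2 ^ m - 1 + 2 * m"
  shows "(\<exists>A' B' q'. is_strategy G (2 ^ N) A' B' \<and>
            accept G (copies N (Psi l)) A' B' = complex_of_real q' \<and>
            q' \<ge> F m l * q) \<and>
         F m l * q \<ge> l\<^sup>2 * q"
proof
  let ?d = "2 ^ m :: nat"
  define c where "c = correlation G A B"
  have psd: "psd_kernel ?d c"
    unfolding c_def by (rule psd_kernel_correlation) fact+
  have "complex_of_real q = (\<Sum>i<?d. \<Sum>j<?d. c i j) / 2 ^ m"
    using assms(6) accept_copies_Psi[OF assms(5), of 1] by (simp add: epr_eq_Psi c_def)
  moreover have "quad ?d c (\<lambda>_. 1) = (\<Sum>i<?d. \<Sum>j<?d. c i j)"
    by (simp add: quad_def)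
  ultimately have q: "complex_of_real q = quad ?d c (\<lambda>_. 1) / complex_of_real (2 ^ m)"
    "complex_of_real q = (\<Sum>i<?d. \<Sum>j<?d. c i j) / complex_of_real (2 ^ m)"
    by simp_all
  \<comment> \<open>Up to the factor \<open>2 ^ m\<close>, \<open>q\<close> is the form of a
    positive semidefinite kernel at the all-ones vector.\<close>
  have "0 \<le> q"
    using arg_cong[OF q(1), of Re] psd_kernelD[OF psd, of "\<lambda>_. 1"]
    by (simp add: Re_divide_of_real less_eq_complex_def del: of_real_power)
  then show "F m l * q \<ge> l\<^sup>2 * q"
    using F_ge_square assms by (intro mult_right_mono) auto
  define K where "K i j = Re (c i j)" for i j
  have qK: "q = (\<Sum>i<?d. \<Sum>j<?d. K i j) / 2 ^ m"
    using arg_cong[OF q(2), of Re] unfolding K_def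
    by (simp add: Re_divide_of_real del: of_real_power)
  obtain r where r: "r < ?d" and
    ge: "F m l * (\<Sum>i<?d. \<Sum>j<?d. K i j) \<le> (\<Sum>i<?d. \<Sum>j<?d. star_weight l r i j * K i j)"
    using exists_star_weight_ge[OF assms(1-3), of K] psd_kernel_sum_le_trace[OF psd] 
    by (auto simp: K_def)
  let ?\<psi> = "hamming_block m r"
  let ?A = "\<lambda>x a. block_mat (2 ^ N) ?\<psi> (A x a)" and ?B = "\<lambda>y b. block_mat (2 ^ N) ?\<psi> (B y b)"
  \<comment> \<open>The bits beyond the code length, those of the \<open>2 * m\<close> idle copies,
    become part of the name of the block.\<close>
  have N: "2 ^ m - 1 \<le> N" using assms(7) by simp
  note bij = bij_betw_hamming_block[OF N r]
  have acc: "accept G (copies N (Psi l)) ?A ?B =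
      (\<Sum>i<?d. \<Sum>j<?d. of_real (star_weight l r i j) * c i j) / of_nat ?d"
    unfolding c_def using damping_hamming_block[OF N]
    by (intro accept_block_mat[OF bij _ _ assms(5)]) auto
  \<comment> \<open>Real symmetric weights keep the kernel Hermitian, so the weighted sum is real
    and only the real parts \<open>K\<close> contribute.\<close>
  have herm: "of_real (star_weight l r j i) * c j i = cnj (of_real (star_weight l r i j) * c i j)"
    if "i < ?d" "j < ?d" for i j
    by (simp add: psd_kernel_hermitian[OF psd that] star_weight_def)
  have "(\<Sum>i<?d. \<Sum>j<?d. of_real (star_weight l r i j) * c i j) =
      (\<Sum>j<?d. \<Sum>i<?d. of_real (star_weight l r i j) * c i j)"
    by (rule sum.swap)
  also have "\<dots> = cnj (\<Sum>i<?d. \<Sum>j<?d. of_real (star_weight l r i j) * c i j)"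
    unfolding cnj_sum by (intro sum.cong refl herm) auto
  finally have "(\<Sum>i<?d. \<Sum>j<?d. of_real (star_weight l r i j) * c i j) =
      cnj (\<Sum>i<?d. \<Sum>j<?d. of_real (star_weight l r i j) * c i j)" .
  then have "(\<Sum>i<?d. \<Sum>j<?d. of_real (star_weight l r i j) * c i j) =
      of_real (\<Sum>i<?d. \<Sum>j<?d. star_weight l r i j * K i j)"
    unfolding K_def by (simp add: complex_eq_iff sum_negf)
  then have "accept G (copies N (Psi l)) ?A ?B =
      of_real ((\<Sum>i<?d. \<Sum>j<?d. star_weight l r i j * K i j) / 2 ^ m)"
    unfolding acc by simp
  moreover have "F m l * q \<le> (\<Sum>i<?d. \<Sum>j<?d. star_weight l r i j * K i j) / 2 ^ m"
    using ge unfolding qK by (simp add: divide_right_mono)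
  moreover have "is_strategy G (2 ^ N) ?A ?B"
    using is_strategy_block_mat[OF bij _ assms(5)] by simp
  ultimately show "\<exists>A' B' q'. is_strategy G (2 ^ N) A' B' \<and>
      accept G (copies N (Psi l)) A' B' = complex_of_real q' \<and> q' \<ge> F m l * q"
    by blast
qed

end
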